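(* Let $(Q,\cdot,\circ,*,/)$ be a binary algebraic structure, i.e. a set $Q$ with four binary operations $\cdot,\circ,*,/$. The following are equivalent: (i) $(Q,\cdot,\circ,*,/)$ is a stuquandle; (ii) $(Q,\cdot,*,/)$ and $(Q,\circ,*,/)$ are oriented singquandles.
   Context: A quandle is a set $Q$ with two binary operations $*,/$ such that for all $x,y,z\in Q$: $(x*y)/y=x=(x/y)*y$, $x*x=x$, and $(x*y)*z=(x*z)*(y*z)$. An oriented singquandle is a binary algebraic structure $(Q,\cdot,*,/)$ (a set $Q$ with three binary operations) such that $(Q,*,/)$ is a quandle and the following identities hold for all $x,y,z\in Q$: (OS1') $(y\cdot x)*z=(y*z)\cdot(x*z)$; (OS2') $(x\cdot(y\cdot x))*z=(x*z)\cdot((y*z)\cdot(x*z))$; (OS3') $(y*x)*z=(y*(z\cdot x))*((x*z)\cdot z)$; (OS4') $(y\cdot x)*((x*y)\cdot y)=(y*(x*y))\cdot(x*y)$. Saying that $(Q,\circ,*,/)$ is an oriented singquandle means that these conditions hold with $\circ$ in place of $\cdot$. A stuquandle is a binary algebraic structure $(Q,\cdot,\circ,*,/)$ such that $(Q,\cdot,*,/)$ is an oriented singquandle and the following identities hold for all $x,y,z\in Q$: (ST1') $(y\circ x)*((x*y)\circ y)=(y*(x*y))\circ(x*y)$; (ST3') $(x\circ y)*z=(x*z)\circ(y*z)$; (ST5') $(x*((z*y)\circ y))/y=(x/(y\circ z))*z$. *)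

theory Defs
  imports Main
begin

text \<open>
  The operations are total functions on the ambient type; only their restriction to the carrier
  \<open>Q\<close> matters. That they are operations on \<open>Q\<close> is expressed by the closure assumptions.
  As in the text, \<open>Q\<close> is allowed to be empty.
\<close>

definition binary_operation_on :: "'a set \<Rightarrow> ('a \<Rightarrow> 'a \<Rightarrow> 'a) \<Rightarrow> bool" where
  "binary_operation_on Q f \<longleftrightarrow> (\<forall>x\<in>Q. \<forall>y\<in>Q. f x y \<in> Q)"

locale quandle =
  fixes Q :: "'a set"
    and star :: "'a \<Rightarrow> 'a \<Rightarrow> 'a"  (infixl \<open>\<star>\<close> 70)
    and slash :: "'a \<Rightarrow> 'a \<Rightarrow> 'a"  (infixl \<open>\<sslash>\<close> 70)
  assumes star_closed: "binary_operation_on Q (\<star>)"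
    and slash_closed: "binary_operation_on Q (\<sslash>)"
    and star_slash: "\<lbrakk>x \<in> Q; y \<in> Q\<rbrakk> \<Longrightarrow> (x \<star> y) \<sslash> y = x"
    and slash_star: "\<lbrakk>x \<in> Q; y \<in> Q\<rbrakk> \<Longrightarrow> (x \<sslash> y) \<star> y = x"
    and star_idem: "x \<in> Q \<Longrightarrow> x \<star> x = x"
    and star_distrib: "\<lbrakk>x \<in> Q; y \<in> Q; z \<in> Q\<rbrakk> \<Longrightarrow> (x \<star> y) \<star> z = (x \<star> z) \<star> (y \<star> z)"

locale oriented_singquandle = quandle Q star slash
  for Q :: "'a set"
    and dot :: "'a \<Rightarrow> 'a \<Rightarrow> 'a"  (infixl \<open>\<cdot>\<close> 70)
    and star :: "'a \<Rightarrow> 'a \<Rightarrow> 'a"  (infixl \<open>\<star>\<close> 70)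
    and slash :: "'a \<Rightarrow> 'a \<Rightarrow> 'a"  (infixl \<open>\<sslash>\<close> 70) +
  assumes dot_closed: "binary_operation_on Q (\<cdot>)"
    and OS1: "\<lbrakk>x \<in> Q; y \<in> Q; z \<in> Q\<rbrakk> \<Longrightarrow> (y \<cdot> x) \<star> z = (y \<star> z) \<cdot> (x \<star> z)"
    and OS2: "\<lbrakk>x \<in> Q; y \<in> Q; z \<in> Q\<rbrakk> \<Longrightarrow>
      (x \<cdot> (y \<cdot> x)) \<star> z = (x \<star> z) \<cdot> ((y \<star> z) \<cdot> (x \<star> z))"
    and OS3: "\<lbrakk>x \<in> Q; y \<in> Q; z \<in> Q\<rbrakk> \<Longrightarrow>
      (y \<star> x) \<star> z = (y \<star> (z \<cdot> x)) \<star> ((x \<star> z) \<cdot> z)"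
    and OS4: "\<lbrakk>x \<in> Q; y \<in> Q\<rbrakk> \<Longrightarrow>
      (y \<cdot> x) \<star> ((x \<star> y) \<cdot> y) = (y \<star> (x \<star> y)) \<cdot> (x \<star> y)"

locale stuquandle = oriented_singquandle Q dot star slash
  for Q :: "'a set"
    and dot :: "'a \<Rightarrow> 'a \<Rightarrow> 'a"  (infixl \<open>\<cdot>\<close> 70)
    and circ :: "'a \<Rightarrow> 'a \<Rightarrow> 'a"  (infixl \<open>\<odot>\<close> 70)
    and star :: "'a \<Rightarrow> 'a \<Rightarrow> 'a"  (infixl \<open>\<star>\<close> 70)
    and slash :: "'a \<Rightarrow> 'a \<Rightarrow> 'a"  (infixl \<open>\<sslash>\<close> 70) +
  assumes circ_closed: "binary_operation_on Q (\<odot>)"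
    and ST1: "\<lbrakk>x \<in> Q; y \<in> Q\<rbrakk> \<Longrightarrow>
      (y \<odot> x) \<star> ((x \<star> y) \<odot> y) = (y \<star> (x \<star> y)) \<odot> (x \<star> y)"
    and ST3: "\<lbrakk>x \<in> Q; y \<in> Q; z \<in> Q\<rbrakk> \<Longrightarrow> (x \<odot> y) \<star> z = (x \<star> z) \<odot> (y \<star> z)"
    and ST5: "\<lbrakk>x \<in> Q; y \<in> Q; z \<in> Q\<rbrakk> \<Longrightarrow>
      (x \<star> ((z \<star> y) \<odot> y)) \<sslash> y = (x \<sslash> (y \<odot> z)) \<star> z"

end

theory Submission
  imports Defs
begin

text \<open>
  ST1' and ST3' are OS4' and OS1' for \<open>\<circ>\<close>, and OS2' follows from OS1' applied twice. Since right
  translations are invertible, substituting \<open>w * (y \<circ> z)\<close> for \<open>x\<close> in ST5' and multiplying by \<open>y\<close>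
  on the right turns ST5' into OS3'.
\<close>

context quandle
begin

lemma star_in: "\<lbrakk>x \<in> Q; y \<in> Q\<rbrakk> \<Longrightarrow> x \<star> y \<in> Q"
  using star_closed unfolding binary_operation_on_def by blast

lemma slash_in: "\<lbrakk>x \<in> Q; y \<in> Q\<rbrakk> \<Longrightarrow> x \<sslash> y \<in> Q"
  using slash_closed unfolding binary_operation_on_def by blast

text \<open>Both identities involve only the quandle and a single operation, so the equivalence is
  stated for an arbitrary closed \<open>f\<close>; taking \<open>f\<close> to be \<open>circ\<close>
  then serves both directions of the theorem.\<close>

lemma ST5_iff_OS3:
  assumes "binary_operation_on Q f"
  shows "(\<forall>x\<in>Q. \<forall>y\<in>Q. \<forall>z\<in>Q. (x \<star> f (z \<star> y) y) \<sslash> y = (x \<sslash> f y z) \<star> z) \<longleftrightarrow>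
    (\<forall>x\<in>Q. \<forall>y\<in>Q. \<forall>z\<in>Q. (y \<star> x) \<star> z = (y \<star> f z x) \<star> f (x \<star> z) z)"
    (is "?ST5 \<longleftrightarrow> ?OS3")
proof -
  have f_in: "f x y \<in> Q" if "x \<in> Q" "y \<in> Q" for x y
    using assms that unfolding binary_operation_on_def by blast
  show ?thesis
  proof
    assume ST5: ?ST5
    show ?OS3
    proof (intro ballI)
      fix x y z
      assume xyz: "x \<in> Q" "y \<in> Q" "z \<in> Q"
      \<comment> \<open>Instance of ST5' with \<open>y \<star> f z x\<close>, \<open>z\<close>,
        \<open>x\<close> for \<open>x\<close>, \<open>y\<close>, \<open>z\<close>: on its right side
        the division by \<open>f z x\<close> cancels.\<close>
      have "((y \<star> f z x) \<star> f (x \<star> z) z) \<sslash> z = y \<star> x"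
        using ST5 xyz by (simp add: star_in f_in star_slash)
      then show "(y \<star> x) \<star> z = (y \<star> f z x) \<star> f (x \<star> z) z"
        using slash_star[of "(y \<star> f z x) \<star> f (x \<star> z) z" z] xyz by (simp add: star_in f_in)
    qed
  next
    assume OS3: ?OS3
    show ?ST5
    proof (intro ballI)
      fix x y z
      assume xyz: "x \<in> Q" "y \<in> Q" "z \<in> Q"
      \<comment> \<open>Instance of OS3' with \<open>z\<close>, \<open>x \<sslash> f y z\<close>,
        \<open>y\<close> for \<open>x\<close>, \<open>y\<close>, \<open>z\<close>, chosen so that
        \<open>f y z\<close> cancels in the next step.\<close>
      have "((x \<sslash> f y z) \<star> z) \<star> y = ((x \<sslash> f y z) \<star> f y z) \<star> f (z \<star> y) y"
        using OS3 xyz by (simp add: slash_in f_in)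
      also have "\<dots> = x \<star> f (z \<star> y) y"
        using xyz by (simp add: slash_star f_in)
      finally show "(x \<star> f (z \<star> y) y) \<sslash> y = (x \<sslash> f y z) \<star> z"
        using star_slash[of "(x \<sslash> f y z) \<star> z" y] xyz by (simp add: star_in slash_in f_in)
    qed
  qed
qed

end

theorem corollary1p6:
  fixes Q :: "'a set"
    and dot circ star slash :: "'a \<Rightarrow> 'a \<Rightarrow> 'a"
  assumes "binary_operation_on Q dot"
    and "binary_operation_on Q circ"
    and "binary_operation_on Q star"
    and "binary_operation_on Q slash"
  shows "stuquandle Q dot circ star slash \<longleftrightarrow>
    oriented_singquandle Q dot star slash \<and> oriented_singquandle Q circ star slash"
proof
  assume stu: "stuquandle Q dot circ star slash"
  interpret stuquandle Q dot circ star slash by (fact stu)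
  have circ_in: "circ x y \<in> Q" if "x \<in> Q" "y \<in> Q" for x y
    using circ_closed that unfolding binary_operation_on_def by blast
  have OS3_circ: "\<forall>x\<in>Q. \<forall>y\<in>Q. \<forall>z\<in>Q.
      star (star y x) z = star (star y (circ z x)) (circ (star x z) z)"
    using ST5 ST5_iff_OS3[OF circ_closed] by blast
  have "oriented_singquandle Q circ star slash"
  proof
    show "binary_operation_on Q circ" by (fact circ_closed)
  \<comment> \<open>Closure \<open>circ_in\<close> serves OS2': the outer use of ST3' has
    \<open>circ y x\<close> as an argument.\<close>
  qed (use OS3_circ in \<open>simp_all add: ST1 ST3 circ_in\<close>)
  then show "oriented_singquandle Q dot star slash \<and> oriented_singquandle Q circ star slash"
    using oriented_singquandle_axioms by blast
next
  assume sing: "oriented_singquandle Q dot star slash \<and> oriented_singquandle Q circ star slash"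
  interpret dot: oriented_singquandle Q dot star slash using sing by blast
  interpret circ: oriented_singquandle Q circ star slash using sing by blast
  have ST5_circ: "\<forall>x\<in>Q. \<forall>y\<in>Q. \<forall>z\<in>Q.
      slash (star x (circ (star z y) y)) y = star (slash x (circ y z)) z"
    \<comment> \<open>Both singquandles share one quandle, so the equivalence reached through
      \<open>dot\<close> may be instantiated with \<open>circ\<close>.\<close>
    using circ.OS3 dot.ST5_iff_OS3[OF circ.dot_closed] by blast
  show "stuquandle Q dot circ star slash"
  proof
    show "binary_operation_on Q circ" by (fact circ.dot_closed)
  qed (use ST5_circ in \<open>simp_all add: circ.OS1 circ.OS4\<close>)
qed

end
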